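(* Let $X$ be a centered, nondegenerate, infinitely divisible real random variable with finite variance $V>0$. (i) If $0<v<V$ then $c_*(v)=\infty$. (ii) $c_*(v)<\infty$ for some $v>0$ if and only if $\tau>0$, and then $c_*(v)<\infty$ for every $v\ge V$. (Thus on $[V,\infty)$ finiteness of $c_*(v)$ does not depend on $v$.)
   Context: Standing setting: $X$ is a centered, nondegenerate, infinitely divisible real random variable with variance $0<V=\mathrm{Var}(X)<\infty$, Gaussian variance $a\ge0$ and Lévy measure $\nu$ on $\mathbb{R}\setminus\{0\}$. For all real $t$, $K_X(t)=\log\mathbb{E}e^{tX}=\frac{at^2}{2}+\int_{\mathbb{R}\setminus\{0\}}(e^{tx}-1-tx)\,\nu(dx)\in[0,\infty]$. $\tau=\sup\{t>0:K_X(t)<\infty\}\in[0,\infty]$ (with $\sup\emptyset=0$). Convention: $1/0=\infty$. A pair $(v,c)\in(0,\infty)\times[0,\infty)$ is feasible for $X$ if $K_X(t)\le \frac{vt^2}{2(1-ct)}$ for every $0\le t<1/c$ (for $c=0$: for all $t\ge0$). $c_*(v)=\inf\{c\ge0:(v,c)\text{ is feasible}\}\in[0,\infty]$, with $\inf\emptyset=\infty$. *)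

theory Defs
  imports "HOL-Probability.Probability"
begin

(* The law of X is, for every n >= 1, the law of a sum of n independent random variables
   with a common law N: the coordinates of the n-fold product of N. *)
definition infinitely_divisible :: "'a measure \<Rightarrow> ('a \<Rightarrow> real) \<Rightarrow> bool" where
  "infinitely_divisible M X \<longleftrightarrow>
     (\<forall>n::nat. n \<ge> 1 \<longrightarrow>
        (\<exists>N. real_distribution N \<and>
             distr M borel X = distr (\<Pi>\<^sub>M i\<in>{..<n}. N) borel (\<lambda>\<omega>. \<Sum>i<n. \<omega> i)))"

definition nondegenerate :: "'a measure \<Rightarrow> ('a \<Rightarrow> real) \<Rightarrow> bool" where
  "nondegenerate M X \<longleftrightarrow> \<not> (\<exists>x. AE \<omega> in M. X \<omega> = x)"

definition mgf :: "'a measure \<Rightarrow> ('a \<Rightarrow> real) \<Rightarrow> real \<Rightarrow> ennreal" where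
  "mgf M X t = (\<integral>\<^sup>+ \<omega>. ennreal (exp (t * X \<omega>)) \<partial>M)"

(* The extended logarithm of the expectation of exp (t X); that expectation is never 0
   for a probability measure M. *)
definition K :: "'a measure \<Rightarrow> ('a \<Rightarrow> real) \<Rightarrow> real \<Rightarrow> ereal" where
  "K M X t = (if mgf M X t = \<infinity> then \<infinity> else ereal (ln (enn2real (mgf M X t))))"

(* In ennreal the supremum of the empty set is 0 and the infimum of the empty set
   is infinity; both conventions are used below. *)
definition tau :: "'a measure \<Rightarrow> ('a \<Rightarrow> real) \<Rightarrow> ennreal" where
  "tau M X = Sup {ennreal t | t. t > 0 \<and> K M X t < \<infinity>}"

(* The disjunct c = 0 renders t < 1/c under the convention 1/0 = infinity. *)
definition feasible :: "'a measure \<Rightarrow> ('a \<Rightarrow> real) \<Rightarrow> real \<Rightarrow> real \<Rightarrow> bool" where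
  "feasible M X v c \<longleftrightarrow> v > 0 \<and> c \<ge> 0 \<and>
     (\<forall>t::real. 0 \<le> t \<and> (c = 0 \<or> t < 1 / c) \<longrightarrow>
        K M X t \<le> ereal (v * t\<^sup>2 / (2 * (1 - c * t))))"

definition c_star :: "'a measure \<Rightarrow> ('a \<Rightarrow> real) \<Rightarrow> real \<Rightarrow> ennreal" where
  "c_star M X v = Inf {ennreal c | c. c \<ge> 0 \<and> feasible M X v c}"

end

theory Submission
  imports Defs
begin

text \<open>
  Everything follows from the second-order behaviour of the moment generating function at
  \<open>0+\<close>. As \<open>X\<close> is centered, feasibility says
  \<open>E (e\<^sup>t\<^sup>X - 1 - tX) \<le> exp (v t\<^sup>2 / (2 (1 - c t))) - 1\<close>. After division by \<open>t\<^sup>2\<close> the right-hand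
  side tends to \<open>v / 2\<close> whatever \<open>c\<close> is, while the lower limit of the left-hand side is at
  least \<open>V / 2\<close>, because the integrand is nonnegative and tends to \<open>X\<^sup>2 / 2\<close>. Hence
  feasibility forces \<open>V \<le> v\<close> (lemma \<open>feasible_imp_variance_le\<close>).

  Conversely, a finite exponential moment at a single \<open>t > 0\<close> controls the cubic
  remainder of the exponential on the right tail, and on the left tail that remainder is
  negative. So \<open>E e\<^sup>s\<^sup>X \<le> 1 + V s\<^sup>2 / 2 + C s\<^sup>3\<close> for \<open>0 \<le> s \<le> t / 2\<close>
  (lemma \<open>expectation_exp_le_cubic\<close>), and \<open>1 + y \<le> e\<^sup>y\<close> turns this into a bound on
  \<open>K\<close>. The expansion
  \<open>V s\<^sup>2 / (2 (1 - c s)) \<ge> V s\<^sup>2 / 2 + c V s\<^sup>3 / 2\<close> absorbs the cubic term once \<open>c\<close> is large,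
  and a large \<open>c\<close> also restricts \<open>s < 1 / c\<close> to the range where the bound holds
  (lemma \<open>ex_feasible\<close>).

  So \<open>v = V\<close> already has a feasible \<open>c\<close> as soon as any exponential moment on the right
  exists, and larger \<open>v\<close> only weaken the requirement. In the other direction a feasible
  \<open>c\<close> makes \<open>K\<close> finite on a right neighbourhood of \<open>0\<close>, which gives \<open>tau > 0\<close>.
\<close>

lemma exp_le_quadratic_plus_cubic:
  fixes y :: real
  shows "exp y \<le> 1 + y + y\<^sup>2 / 2 + (if y \<ge> 0 then y ^ 3 / 6 * exp y else 0)"
proof -
  obtain u where u: "\<bar>u\<bar> \<le> \<bar>y\<bar>" and e: "exp y = (\<Sum>m<3. y ^ m / fact m) + exp u / fact 3 * y ^ 3"
    using Maclaurin_exp_le[of y 3] by blast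
  have e': "exp y = 1 + y + y\<^sup>2 / 2 + exp u / 6 * y ^ 3"
    using e by (simp add: eval_nat_numeral)
  show ?thesis
  proof (cases "y \<ge> 0")
    case True
    then have "exp u * y ^ 3 \<le> exp y * y ^ 3"
      using u by (intro mult_right_mono) auto
    then show ?thesis using e' True by (simp add: mult.commute)
  next
    case False
    then have "y ^ 3 \<le> 0" by (simp add: power_le_zero_eq)
    then have "exp u / 6 * y ^ 3 \<le> 0" by (simp add: mult_le_0_iff)
    then show ?thesis using e' False by simp
  qed
qed

lemma cube_le_exp:
  fixes z :: real
  assumes "z \<ge> 0"
  shows "z ^ 3 / 6 \<le> exp z"
proof -
  obtain u where "exp z = (\<Sum>m<4. z ^ m / fact m) + exp u / fact 4 * z ^ 4"
    using Maclaurin_exp_le[of z 4] by blast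
  moreover have "(\<Sum>m<4. z ^ m / fact m) = 1 + z + z\<^sup>2 / 2 + z ^ 3 / 6"
    by (simp add: eval_nat_numeral)
  moreover have "exp u / fact 4 * z ^ 4 \<ge> 0" using assms by simp
  ultimately show ?thesis using assms by (smt (verit) zero_le_power2 divide_nonneg_pos)
qed

text \<open>
  Half of the exponent \<open>t x\<close> dominates \<open>e\<^sup>s\<^sup>x\<close> and the other half the cube of \<open>x\<close>,
  which is where the restriction \<open>s \<le> t / 2\<close> comes from.
\<close>

lemma exp_mult_le_cubic:
  fixes s t x :: real
  assumes "0 \<le> s" "s \<le> t / 2" "0 < t"
  shows "exp (s * x) \<le> 1 + s * x + s\<^sup>2 * x\<^sup>2 / 2 + 8 / t ^ 3 * s ^ 3 * exp (t * x)"
proof (cases "x \<ge> 0")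
  case True
  let ?z = "t * x / 2"
  have z: "?z \<ge> 0" using True assms by simp
  have y: "s * x \<ge> 0" using True assms by simp
  have "x ^ 3 / 6 = 8 / t ^ 3 * (?z ^ 3 / 6)"
    using assms by (simp add: field_simps)
  also have "\<dots> \<le> 8 / t ^ 3 * exp ?z"
    using cube_le_exp[OF z] assms by (intro mult_left_mono) auto
  finally have cube: "x ^ 3 / 6 \<le> 8 / t ^ 3 * exp ?z" .
  have ex: "exp (s * x) \<le> exp ?z"
    using mult_right_mono[OF assms(2) True] by simp
  have "(s * x) ^ 3 / 6 * exp (s * x) = s ^ 3 * (x ^ 3 / 6) * exp (s * x)"
    by (simp add: power_mult_distrib)
  also have "\<dots> \<le> s ^ 3 * (8 / t ^ 3 * exp ?z) * exp ?z"
    using cube ex assms True by (intro mult_mono mult_left_mono) auto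
  also have "\<dots> = 8 / t ^ 3 * s ^ 3 * exp (t * x)"
    by (simp add: mult_exp_exp)
  finally have "(s * x) ^ 3 / 6 * exp (s * x) \<le> 8 / t ^ 3 * s ^ 3 * exp (t * x)" .
  then show ?thesis
    using exp_le_quadratic_plus_cubic[of "s * x"] y by (simp add: power_mult_distrib)
next
  case False
  have "s * x \<le> 0" using False assms by (simp add: mult_nonneg_nonpos)
  then have "exp (s * x) \<le> 1 + s * x + (s * x)\<^sup>2 / 2"
    using exp_le_quadratic_plus_cubic[of "s * x"] by (cases "s * x = 0") auto
  moreover have "0 \<le> 8 / t ^ 3 * s ^ 3 * exp (t * x)" using assms by simp
  ultimately show ?thesis by (simp add: power_mult_distrib)
qed

lemma tendsto_exp_minus_linear_over_square:
  fixes x :: real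
  shows "((\<lambda>t. (exp (t * x) - 1 - t * x) / t\<^sup>2) \<longlongrightarrow> x\<^sup>2 / 2) (at_right 0)"
  by (cases x "0 :: real" rule: linorder_cases) (real_asymp simp: power2_eq_square)+

lemma K_less_top_iff:
  "K M X t < \<infinity> \<longleftrightarrow> mgf M X t < \<infinity>"
  by (auto simp: K_def top.not_eq_extremum)

lemma integrable_exp_iff_mgf:
  assumes "X \<in> borel_measurable M"
  shows "integrable M (\<lambda>\<omega>. exp (t * X \<omega>)) \<longleftrightarrow> mgf M X t < \<infinity>"
  using assms by (simp add: integrable_iff_bounded mgf_def)

lemma mgf_eq_expectation:
  assumes "integrable M (\<lambda>\<omega>. exp (t * X \<omega>))"
  shows "mgf M X t = ennreal (\<integral>\<omega>. exp (t * X \<omega>) \<partial>M)"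
  unfolding mgf_def using assms by (intro nn_integral_eq_integral) auto

context prob_space
begin

text \<open>
  This removes the extended logarithm: the value \<open>\<infinity>\<close> of \<open>K\<close> becomes non-integrability,
  and elsewhere the expectation is positive, so that \<open>ln\<close> inverts \<open>exp\<close>.
\<close>

lemma K_le_iff:
  assumes X: "X \<in> borel_measurable M"
  shows "K M X t \<le> ereal b \<longleftrightarrow>
    integrable M (\<lambda>\<omega>. exp (t * X \<omega>)) \<and> expectation (\<lambda>\<omega>. exp (t * X \<omega>)) \<le> exp b"
proof (cases "mgf M X t < \<infinity>")
  case True
  then have int: "integrable M (\<lambda>\<omega>. exp (t * X \<omega>))"
    using integrable_exp_iff_mgf[OF X] by simp
  have pos: "expectation (\<lambda>\<omega>. exp (t * X \<omega>)) > 0"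
    by (intro expectation_greater[where a = 0, simplified]) (use int in auto)
  have "K M X t = ereal (ln (expectation (\<lambda>\<omega>. exp (t * X \<omega>))))"
    using True mgf_eq_expectation[OF int] pos by (simp add: K_def)
  then show ?thesis using int pos by (metis exp_le_cancel_iff exp_ln ereal_less_eq(3))
next
  case False
  then have "K M X t = \<infinity>" by (simp add: K_def less_top[symmetric])
  then show ?thesis using False integrable_exp_iff_mgf[OF X] by simp
qed

text \<open>
  The range of \<open>t\<close> tested by feasibility always contains a positive number, for instance
  \<open>1 / (c + 1)\<close>, and the bound required there is finite.
\<close>

lemma feasible_imp_tau_pos:
  assumes "feasible M X v c"
  shows "tau M X > 0"
proof -
  have c: "c \<ge> 0" using assms by (simp add: feasible_def)
  have "1 / (c + 1) > 0 \<and> (c = 0 \<or> 1 / (c + 1) < 1 / c)"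
    using c by (cases "c = 0") (auto intro!: divide_strict_left_mono)
  then obtain t where t: "t > 0" "c = 0 \<or> t < 1 / c" by blast
  then have "K M X t \<le> ereal (v * t\<^sup>2 / (2 * (1 - c * t)))"
    using assms by (simp add: feasible_def)
  then have "K M X t < \<infinity>" by (auto simp: less_eq_ereal_def)
  then have "ennreal t \<le> tau M X"
    unfolding tau_def using t by (intro Sup_upper) auto
  then show ?thesis using t by (metis ennreal_less_zero_iff less_le_trans)
qed

text \<open>
  Only a lower bound on the expectation of \<open>(e\<^sup>t\<^sup>X - 1 - tX) / t\<^sup>2\<close> is wanted, so this
  quotient may be cut off at \<open>X\<^sup>2\<close>: that leaves its limit \<open>X\<^sup>2 / 2\<close> unchanged and
  supplies a dominating function that is integrable because \<open>X\<close> has finite variance.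
\<close>

lemma feasible_imp_variance_le:
  assumes X: "X \<in> borel_measurable M" and int: "integrable M X"
    and mean: "expectation X = 0" and int2: "integrable M (\<lambda>\<omega>. (X \<omega>)\<^sup>2)"
    and feas: "feasible M X v c"
  shows "variance X \<le> v"
proof -
  define q where "q = (\<lambda>t x :: real. (exp (t * x) - 1 - t * x) / t\<^sup>2)"
  define s where "s = (\<lambda>n. 1 / (real n + 1))"
  have s_pos: "s n > 0" for n by (simp add: s_def)
  have s_lim: "filterlim s (at_right 0) sequentially"
    unfolding s_def by real_asymp
  have c: "c \<ge> 0" using feas by (simp add: feasible_def)
  have q_nonneg: "q t x \<ge> 0" for t x
    unfolding q_def using exp_ge_add_one_self[of "t * x"]
    by (intro divide_nonneg_nonneg zero_le_power2) linarith
  have lim: "(\<lambda>n. expectation (\<lambda>\<omega>. min ((X \<omega>)\<^sup>2) (q (s n) (X \<omega>))))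
      \<longlonglongrightarrow> expectation (\<lambda>\<omega>. (X \<omega>)\<^sup>2 / 2)"
  proof (rule integral_dominated_convergence[where w = "\<lambda>\<omega>. (X \<omega>)\<^sup>2"])
    show "AE \<omega> in M. (\<lambda>n. min ((X \<omega>)\<^sup>2) (q (s n) (X \<omega>))) \<longlonglongrightarrow> (X \<omega>)\<^sup>2 / 2"
    proof (rule AE_I2)
      fix \<omega>
      have "(\<lambda>n. q (s n) (X \<omega>)) \<longlonglongrightarrow> (X \<omega>)\<^sup>2 / 2"
        unfolding q_def
        by (rule filterlim_compose[OF tendsto_exp_minus_linear_over_square s_lim])
      then have "(\<lambda>n. min ((X \<omega>)\<^sup>2) (q (s n) (X \<omega>))) \<longlonglongrightarrow> min ((X \<omega>)\<^sup>2) ((X \<omega>)\<^sup>2 / 2)"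
        by (intro tendsto_min tendsto_const)
      then show "(\<lambda>n. min ((X \<omega>)\<^sup>2) (q (s n) (X \<omega>))) \<longlonglongrightarrow> (X \<omega>)\<^sup>2 / 2"
        by (simp add: min_def split: if_splits)
    qed
    show "AE \<omega> in M. norm (min ((X \<omega>)\<^sup>2) (q (s n) (X \<omega>))) \<le> (X \<omega>)\<^sup>2" for n
      using q_nonneg by (intro AE_I2) (simp add: min_def)
  qed (use X int2 in \<open>auto simp: q_def\<close>)
  have small: "eventually (\<lambda>t. c * t < 1) (at_right (0 :: real))"
    by (rule order_tendstoD(2)[of _ 0]) (auto intro!: tendsto_eq_intros)
  have bound: "eventually (\<lambda>n. expectation (\<lambda>\<omega>. min ((X \<omega>)\<^sup>2) (q (s n) (X \<omega>)))
      \<le> (exp (v * (s n)\<^sup>2 / (2 * (1 - c * s n))) - 1) / (s n)\<^sup>2) sequentially"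
    using filterlim_iff[THEN iffD1, OF s_lim, rule_format, OF small]
  proof eventually_elim
    case (elim n)
    let ?t = "s n"
    have "c = 0 \<or> ?t < 1 / c" using elim c
      by (cases "c = 0") (auto simp: pos_less_divide_eq mult.commute)
    then have "K M X ?t \<le> ereal (v * ?t\<^sup>2 / (2 * (1 - c * ?t)))"
      using feas s_pos[of n] by (simp add: feasible_def)
    then have exp_int: "integrable M (\<lambda>\<omega>. exp (?t * X \<omega>))"
      and exp_le: "expectation (\<lambda>\<omega>. exp (?t * X \<omega>)) \<le> exp (v * ?t\<^sup>2 / (2 * (1 - c * ?t)))"
      using K_le_iff[OF X] by auto
    have q_int: "integrable M (\<lambda>\<omega>. q ?t (X \<omega>))"
      unfolding q_def using exp_int int by (intro integrable_divide) auto
    have "expectation (\<lambda>\<omega>. min ((X \<omega>)\<^sup>2) (q ?t (X \<omega>))) \<le> expectation (\<lambda>\<omega>. q ?t (X \<omega>))"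
      using int2 q_int by (intro integral_mono integrable_min) auto
    also have "\<dots> = (expectation (\<lambda>\<omega>. exp (?t * X \<omega>)) - 1) / ?t\<^sup>2"
      unfolding q_def using exp_int int mean by (simp add: prob_space)
    also have "\<dots> \<le> (exp (v * ?t\<^sup>2 / (2 * (1 - c * ?t))) - 1) / ?t\<^sup>2"
      using exp_le by (intro divide_right_mono) auto
    finally show ?case .
  qed
  have "((\<lambda>t. (exp (v * t\<^sup>2 / (2 * (1 - c * t))) - 1) / t\<^sup>2) \<longlongrightarrow> v / 2) (at_right 0)"
    using feas c by (cases "c = 0") (auto simp: feasible_def; real_asymp)+
  then have "(\<lambda>n. (exp (v * (s n)\<^sup>2 / (2 * (1 - c * s n))) - 1) / (s n)\<^sup>2) \<longlonglongrightarrow> v / 2"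
    by (rule filterlim_compose[OF _ s_lim])
  from tendsto_le[OF sequentially_bot this lim bound]
  show ?thesis using mean by simp
qed

lemma expectation_exp_le_cubic:
  fixes s t :: real
  assumes X: "X \<in> borel_measurable M" and int: "integrable M X"
    and mean: "expectation X = 0" and int2: "integrable M (\<lambda>\<omega>. (X \<omega>)\<^sup>2)"
    and exp_int: "integrable M (\<lambda>\<omega>. exp (t * X \<omega>))"
    and s: "0 \<le> s" "s \<le> t / 2" and t: "0 < t"
  shows "integrable M (\<lambda>\<omega>. exp (s * X \<omega>))"
    and "expectation (\<lambda>\<omega>. exp (s * X \<omega>))
      \<le> 1 + variance X * s\<^sup>2 / 2 + 8 / t ^ 3 * s ^ 3 * expectation (\<lambda>\<omega>. exp (t * X \<omega>))"
proof -
  let ?u = "\<lambda>\<omega>. 1 + s * X \<omega> + s\<^sup>2 * (X \<omega>)\<^sup>2 / 2 + 8 / t ^ 3 * s ^ 3 * exp (t * X \<omega>)"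
  have le: "exp (s * X \<omega>) \<le> ?u \<omega>" for \<omega>
    using exp_mult_le_cubic[OF s t] .
  have u_int: "integrable M ?u"
    using int int2 exp_int by (intro Bochner_Integration.integrable_add) auto
  show *: "integrable M (\<lambda>\<omega>. exp (s * X \<omega>))"
    by (rule Bochner_Integration.integrable_bound[OF u_int])
      (use X le in \<open>auto intro: order_trans[OF _ abs_ge_self]\<close>)
  have "expectation (\<lambda>\<omega>. exp (s * X \<omega>)) \<le> expectation ?u"
    using * u_int le by (intro integral_mono) auto
  also have "\<dots> = 1 + variance X * s\<^sup>2 / 2
      + 8 / t ^ 3 * s ^ 3 * expectation (\<lambda>\<omega>. exp (t * X \<omega>))"
    using int int2 exp_int mean by (simp add: prob_space)
  finally show "expectation (\<lambda>\<omega>. exp (s * X \<omega>)) \<le> \<dots>" .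
qed

lemma ex_feasible:
  assumes X: "X \<in> borel_measurable M" and int: "integrable M X"
    and mean: "expectation X = 0" and int2: "integrable M (\<lambda>\<omega>. (X \<omega>)\<^sup>2)"
    and pos: "variance X > 0" and tau: "tau M X > 0" and v: "v \<ge> variance X"
  shows "\<exists>c\<ge>0. feasible M X v c"
proof -
  define V where "V = variance X"
  obtain t where t: "t > 0" and "K M X t < \<infinity>"
    using tau unfolding tau_def by (auto simp: less_Sup_iff)
  then have exp_int: "integrable M (\<lambda>\<omega>. exp (t * X \<omega>))"
    using K_less_top_iff integrable_exp_iff_mgf[OF X] by blast
  define m where "m = expectation (\<lambda>\<omega>. exp (t * X \<omega>))"
  \<comment> \<open>The first argument of \<open>max\<close> confines \<open>s < 1 / c\<close> to \<open>s < t / 2\<close>, the second gives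
    \<open>c V / 2 \<ge> 8 m / t\<^sup>3\<close>, the coefficient of the cubic term.\<close>
  define c where "c = max (2 / t) (16 * m / (V * t ^ 3))"
  have V: "V > 0" using pos by (simp add: V_def)
  have c_pos: "c > 0" using t by (simp add: c_def less_max_iff_disj)
  have c1: "2 / t \<le> c" and "16 * m / (V * t ^ 3) \<le> c" by (auto simp: c_def)
  then have c2: "8 / t ^ 3 * m \<le> V * c / 2" using V t by (simp add: field_simps)
  have "K M X s \<le> ereal (v * s\<^sup>2 / (2 * (1 - c * s)))" if s: "0 \<le> s" "s < 1 / c" for s
  proof -
    have cs: "c * s < 1" using s c_pos by (simp add: field_simps)
    have "2 / t * s \<le> c * s" using c1 s by (intro mult_right_mono)
    then have "2 / t * s \<le> 1" using cs by simp
    then have st: "s \<le> t / 2" using t by (simp add: field_simps)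
    note bnd = expectation_exp_le_cubic[OF X int mean int2 exp_int s(1) st t]
    have "8 / t ^ 3 * s ^ 3 * m = 8 / t ^ 3 * m * s ^ 3" by simp
    also have "\<dots> \<le> V * c / 2 * s ^ 3"
      using c2 s by (intro mult_right_mono) auto
    finally have "V * s\<^sup>2 / 2 + 8 / t ^ 3 * s ^ 3 * m \<le> V * s\<^sup>2 / 2 * (1 + c * s)"
      by (simp add: algebra_simps power2_eq_square power3_eq_cube)
    also have "\<dots> \<le> V * s\<^sup>2 / 2 * (1 / (1 - c * s))"
    proof (intro mult_left_mono)
      have "(1 + c * s) * (1 - c * s) = 1 - (c * s)\<^sup>2"
        by (simp add: algebra_simps power2_eq_square)
      then have "(1 + c * s) * (1 - c * s) \<le> 1" by simp
      then show "1 + c * s \<le> 1 / (1 - c * s)" using cs by (simp add: pos_le_divide_eq)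
    qed (use V in auto)
    also have "\<dots> = V * s\<^sup>2 / (2 * (1 - c * s))" by simp
    also have "\<dots> \<le> v * s\<^sup>2 / (2 * (1 - c * s))"
      using v cs by (intro divide_right_mono mult_right_mono) (auto simp: V_def)
    finally have le: "V * s\<^sup>2 / 2 + 8 / t ^ 3 * s ^ 3 * m \<le> v * s\<^sup>2 / (2 * (1 - c * s))" .
    have "expectation (\<lambda>\<omega>. exp (s * X \<omega>)) \<le> 1 + (V * s\<^sup>2 / 2 + 8 / t ^ 3 * s ^ 3 * m)"
      using bnd(2) by (simp add: V_def m_def)
    also have "\<dots> \<le> 1 + v * s\<^sup>2 / (2 * (1 - c * s))" using le by simp
    also have "\<dots> \<le> exp (v * s\<^sup>2 / (2 * (1 - c * s)))" by (rule exp_ge_add_one_self)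
    finally show ?thesis using K_le_iff[OF X] bnd(1) by blast
  qed
  then have "feasible M X v c"
    using c_pos V v by (auto simp: feasible_def V_def)
  then show ?thesis using c_pos by (intro exI[of _ c]) auto
qed

end

lemma c_star_less_top_iff:
  "c_star M X v < \<infinity> \<longleftrightarrow> (\<exists>c\<ge>0. feasible M X v c)"
  by (auto simp: c_star_def Inf_less_iff)

theorem proposition3p4:
  fixes M :: "'a measure" and X :: "'a \<Rightarrow> real" and V :: real
  assumes "prob_space M"
    and "X \<in> borel_measurable M"
    and "infinitely_divisible M X"
    and "nondegenerate M X"
    and "integrable M X"
    and "prob_space.expectation M X = 0"
    and "integrable M (\<lambda>\<omega>. (X \<omega>)\<^sup>2)"
    and "V = prob_space.variance M X"
    and "V > 0"
  shows "(\<forall>v. 0 < v \<and> v < V \<longrightarrow> c_star M X v = \<infinity>)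
    \<and> ((\<exists>v>0. c_star M X v < \<infinity>) \<longleftrightarrow> tau M X > 0)
    \<and> (tau M X > 0 \<longrightarrow> (\<forall>v\<ge>V. c_star M X v < \<infinity>))
    \<and> (\<forall>v\<ge>V. \<forall>w\<ge>V. c_star M X v < \<infinity> \<longleftrightarrow> c_star M X w < \<infinity>)"
proof -
  interpret prob_space M by fact
  note X = assms(2,5,6,7)
  have necessary: "V \<le> v \<and> tau M X > 0" if "c_star M X v < \<infinity>" for v
  proof -
    obtain c where "feasible M X v c" using \<open>c_star M X v < \<infinity>\<close> c_star_less_top_iff by blast
    then show ?thesis
      using feasible_imp_variance_le[OF X] feasible_imp_tau_pos assms(8) by simp
  qed
  have sufficient: "c_star M X v < \<infinity>" if "tau M X > 0" "v \<ge> V" for v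
    using ex_feasible[OF X] that assms(8,9) c_star_less_top_iff by blast
  have "c_star M X v = \<infinity>" if "v < V" for v
    using necessary[of v] that by (auto simp: less_top[symmetric])
  then show ?thesis
    using necessary sufficient assms(9) by blast
qed

end
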